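(* Let $G$ be a small category and let $A$ be a simple $G$-graded ring such that $A/A_0$ is ideal associative and $A$ is locally unital. Then $A_0$ is $A$-simple.
   Context: Rings are neither necessarily associative nor necessarily unital. Ideals are two-sided. A ring is simple if it has no ideals other than $\{0\}$ and itself. For subsets $X,Y$ of $A$, $XY$ denotes the set of all finite sums of products $xy$ with $x\in X$, $y\in Y$. For a small category $G$, $\mathrm{ob}(G)$ and $\mathrm{mor}(G)$ are its objects and morphisms (objects are identified with their identity morphisms), $d(g)$ and $c(g)$ are the domain and codomain of a morphism $g$, and $G^{(2)}$ is the set of pairs $(g,h)$ of morphisms with $d(g)=c(h)$. A ring $A$ is $G$-graded if there are additive subgroups $A_g$ ($g\in\mathrm{mor}(G)$) with $A=\bigoplus_{g}A_g$, $A_gA_h\subseteq A_{gh}$ if $(g,h)\in G^{(2)}$, and $A_gA_h=\{0\}$ otherwise. $A_0=\bigoplus_{e\in\mathrm{ob}(G)}A_e$. $A$ is locally unital if for every $e\in\mathrm{ob}(G)$ the ring $A_e$ is non-zero and unital, making every $A_g$ a unital $A_{c(g)}$-$A_{d(g)}$-bimodule. An ideal $I$ of $A_0$ is $A$-invariant if $AI\subseteq IA$; $A_0$ is $A$-simple if there is no non-trivial $A$-invariant ideal of $A_0$ (i.e. none other than $\{0\}$ and $A_0$). $A/A_0$ is ideal associative if any ideal $I$ of $A_0$ associates with any finite collection of copies of $A$, i.e. in any product of $I$ with finitely many copies of $A$, written in a given order, all ways of inserting parentheses give the same set; for instance $(IA)A=I(AA)$, $(AI)A=A(IA)$ and $(AA)I=A(AI)$.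 *)

theory Defs
  imports Main
begin

text \<open>Rings that need be neither associative nor unital; the zero ring is allowed.\<close>

class nonassoc_ring = ab_group_add + times +
  assumes nonassoc_distrib_right: "(x + y) * z = x * z + y * z"
    and nonassoc_distrib_left: "x * (y + z) = x * y + x * z"

text \<open>A small category whose objects are identified with their identity morphisms. The
  composite \<open>comp g h\<close> is meaningful only if \<open>d g = c h\<close>.\<close>

locale small_category =
  fixes ob mor :: "'g set" and d c :: "'g \<Rightarrow> 'g" and comp :: "'g \<Rightarrow> 'g \<Rightarrow> 'g"
  assumes ob_subset: "ob \<subseteq> mor"
    and d_in: "g \<in> mor \<Longrightarrow> d g \<in> ob"
    and c_in: "g \<in> mor \<Longrightarrow> c g \<in> ob"
    and d_ob: "e \<in> ob \<Longrightarrow> d e = e"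
    and c_ob: "e \<in> ob \<Longrightarrow> c e = e"
    and comp_in: "\<lbrakk>g \<in> mor; h \<in> mor; d g = c h\<rbrakk> \<Longrightarrow> comp g h \<in> mor"
    and d_comp: "\<lbrakk>g \<in> mor; h \<in> mor; d g = c h\<rbrakk> \<Longrightarrow> d (comp g h) = d h"
    and c_comp: "\<lbrakk>g \<in> mor; h \<in> mor; d g = c h\<rbrakk> \<Longrightarrow> c (comp g h) = c g"
    and comp_id_left: "g \<in> mor \<Longrightarrow> comp (c g) g = g"
    and comp_id_right: "g \<in> mor \<Longrightarrow> comp g (d g) = g"
    and comp_assoc: "\<lbrakk>g \<in> mor; h \<in> mor; k \<in> mor; d g = c h; d h = c k\<rbrakk>
      \<Longrightarrow> comp (comp g h) k = comp g (comp h k)"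

definition additive_subgroup :: "'a::ab_group_add set \<Rightarrow> bool" where
  "additive_subgroup H \<longleftrightarrow> 0 \<in> H \<and> (\<forall>x\<in>H. \<forall>y\<in>H. x + y \<in> H) \<and> (\<forall>x\<in>H. - x \<in> H)"

text \<open>\<open>set_mult X Y\<close> is the set of finite sums of products, not just the set of products.\<close>

definition set_mult :: "'a::nonassoc_ring set \<Rightarrow> 'a set \<Rightarrow> 'a set" (infixl "\<bullet>" 70) where
  "X \<bullet> Y = {(\<Sum>i<n. x i * y i) | (n::nat) x y. \<forall>i<n. x i \<in> X \<and> y i \<in> Y}"

definition sum_of_subgroups :: "'g set \<Rightarrow> ('g \<Rightarrow> 'a::ab_group_add set) \<Rightarrow> 'a set" where
  "sum_of_subgroups J A =
     {(\<Sum>g\<in>F. x g) | F x. finite F \<and> F \<subseteq> J \<and> (\<forall>g\<in>F. x g \<in> A g)}"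

definition is_direct_sum :: "'a::ab_group_add set \<Rightarrow> 'g set \<Rightarrow> ('g \<Rightarrow> 'a set) \<Rightarrow> bool" where
  "is_direct_sum S J A \<longleftrightarrow>
     S = sum_of_subgroups J A \<and>
     (\<forall>F x. finite F \<and> F \<subseteq> J \<and> (\<forall>g\<in>F. x g \<in> A g) \<and> (\<Sum>g\<in>F. x g) = 0
        \<longrightarrow> (\<forall>g\<in>F. x g = 0))"

text \<open>In all that follows the ambient ring is the whole type \<open>'a\<close>, and
  its subrings are given as subsets.\<close>

locale category_graded_ring = small_category ob mor d c comp
  for ob mor :: "'g set" and d c :: "'g \<Rightarrow> 'g" and comp :: "'g \<Rightarrow> 'g \<Rightarrow> 'g" +
  fixes A :: "'g \<Rightarrow> 'a::nonassoc_ring set"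
  assumes component_subgroup: "g \<in> mor \<Longrightarrow> additive_subgroup (A g)"
    and direct_sum: "is_direct_sum UNIV mor A"
    and mult_composable: "\<lbrakk>g \<in> mor; h \<in> mor; d g = c h\<rbrakk> \<Longrightarrow> A g \<bullet> A h \<subseteq> A (comp g h)"
    and mult_not_composable: "\<lbrakk>g \<in> mor; h \<in> mor; d g \<noteq> c h\<rbrakk> \<Longrightarrow> A g \<bullet> A h = {0}"

text \<open>The subring \<open>A\<^sub>0\<close>. For a graded ring the sum is automatically direct, as \<open>ob \<subseteq> mor\<close>.\<close>

definition object_part :: "'g set \<Rightarrow> ('g \<Rightarrow> 'a::nonassoc_ring set) \<Rightarrow> 'a set" where
  "object_part ob A = sum_of_subgroups ob A"

definition ideal_of :: "'a::nonassoc_ring set \<Rightarrow> 'a set \<Rightarrow> bool" where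
  "ideal_of I R \<longleftrightarrow> I \<subseteq> R \<and> additive_subgroup I \<and>
     (\<forall>r\<in>R. \<forall>x\<in>I. r * x \<in> I \<and> x * r \<in> I)"

definition simple_ring :: "'a::nonassoc_ring set \<Rightarrow> bool" where
  "simple_ring R \<longleftrightarrow> (\<forall>I. ideal_of I R \<longrightarrow> I = {0} \<or> I = R)"

definition identity_of :: "'a::nonassoc_ring \<Rightarrow> 'a set \<Rightarrow> bool" where
  "identity_of u R \<longleftrightarrow> u \<in> R \<and> (\<forall>x\<in>R. u * x = x \<and> x * u = x)"

text \<open>Over non-associative rings a bimodule is an additive group with biadditive left and right
  actions, with no associativity required. The multiplication of the graded ring always provides
  such actions on \<open>A g\<close>, so only unitality remains to be demanded.\<close>

definition locally_unital ::
  "'g set \<Rightarrow> 'g set \<Rightarrow> ('g \<Rightarrow> 'g) \<Rightarrow> ('g \<Rightarrow> 'g) \<Rightarrow> ('g \<Rightarrow> 'a::nonassoc_ring set) \<Rightarrow> bool" where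
  "locally_unital ob mor d c A \<longleftrightarrow>
     (\<forall>e\<in>ob. A e \<noteq> {0} \<and> (\<exists>u. identity_of u (A e))) \<and>
     (\<forall>g\<in>mor. \<forall>u v. identity_of u (A (c g)) \<and> identity_of v (A (d g)) \<longrightarrow>
        (\<forall>x\<in>A g. u * x = x \<and> x * v = x))"

text \<open>A product of sets written with all its parentheses.\<close>

datatype 'a bracketing = Factor "'a set" | Product "'a bracketing" "'a bracketing"

primrec factors :: "'a bracketing \<Rightarrow> 'a set list" where
  "factors (Factor X) = [X]"
| "factors (Product s t) = factors s @ factors t"

primrec product_of :: "'a::nonassoc_ring bracketing \<Rightarrow> 'a set" where
  "product_of (Factor X) = X"
| "product_of (Product s t) = product_of s \<bullet> product_of t"

text \<open>\<open>A/B\<close> is ideal associative, for a subring \<open>B\<close> of the ambient ring \<open>A\<close>.\<close>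

definition ideal_associative :: "'a::nonassoc_ring set \<Rightarrow> bool" where
  "ideal_associative B \<longleftrightarrow>
     (\<forall>I. ideal_of I B \<longrightarrow>
       (\<forall>m n s t. factors s = replicate m UNIV @ [I] @ replicate n UNIV \<and> factors t = factors s
          \<longrightarrow> product_of s = product_of t))"

definition invariant :: "'a::nonassoc_ring set \<Rightarrow> bool" where
  "invariant I \<longleftrightarrow> UNIV \<bullet> I \<subseteq> I \<bullet> UNIV"

text \<open>\<open>B\<close> is \<open>A\<close>-simple, where \<open>A\<close> is the ambient ring.\<close>

definition relatively_simple :: "'a::nonassoc_ring set \<Rightarrow> bool" where
  "relatively_simple B \<longleftrightarrow> (\<forall>I. ideal_of I B \<and> invariant I \<longrightarrow> I = {0} \<or> I = B)"

end

(* For an A-invariant ideal I of A_0, associativity makes IA an ideal of A, and local units give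
   I \<subseteq> IA. If IA = 0, then I = 0. If IA = A, write A = A_0 + A', where A' is the sum of the components
   A_g with g not an object. Since A_0 A' \<subseteq> A', taking A_0-parts in A = IA yields A_0 \<subseteq> I A_0 \<subseteq> I. *)

theory Submission
  imports Defs
begin

section \<open>Products and sums of subsets\<close>

lemma nonassoc_mult_zero_left [simp]: "(0::'a::nonassoc_ring) * x = 0"
  using nonassoc_distrib_right[of 0 0 x] by simp

lemma nonassoc_mult_zero_right [simp]: "x * (0::'a::nonassoc_ring) = 0"
  using nonassoc_distrib_left[of x 0 0] by simp

lemma nonassoc_minus_mult_left: "- x * y = - (x * y)" for x :: "'a::nonassoc_ring"
  using nonassoc_distrib_right[of "- x" x y] by (simp add: eq_neg_iff_add_eq_0)

text \<open>Valid over every index set: a sum over an infinite set is 0 by default, and there the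
  claim becomes \<open>0 * x = 0\<close>.\<close>

lemma nonassoc_sum_distrib_right: "(\<Sum>i\<in>F. f i) * x = (\<Sum>i\<in>F. f i * x)"
  for x :: "'a::nonassoc_ring"
  by (induction F rule: infinite_finite_induct) (simp_all add: nonassoc_distrib_right)

lemma nonassoc_sum_distrib_left: "x * (\<Sum>i\<in>F. f i) = (\<Sum>i\<in>F. x * f i)"
  for x :: "'a::nonassoc_ring"
  by (induction F rule: infinite_finite_induct) (simp_all add: nonassoc_distrib_left)

lemma additive_subgroup_sum:
  assumes "additive_subgroup H" "\<And>i. i \<in> F \<Longrightarrow> f i \<in> H"
  shows "(\<Sum>i\<in>F. f i) \<in> H"
  using assms
  by (induction F rule: infinite_finite_induct) (auto simp: additive_subgroup_def)

lemma additive_subgroup_diff: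
  assumes "additive_subgroup H" "x \<in> H" "y \<in> H"
  shows "x - y \<in> H"
proof -
  have "x + - y \<in> H"
    using assms unfolding additive_subgroup_def by blast
  then show ?thesis
    by simp
qed

lemma set_mult_mono: "X \<subseteq> X' \<Longrightarrow> Y \<subseteq> Y' \<Longrightarrow> X \<bullet> Y \<subseteq> X' \<bullet> Y'"
  unfolding set_mult_def by blast

lemma mult_in_set_mult:
  assumes "x \<in> X" "y \<in> Y"
  shows "x * y \<in> X \<bullet> Y"
proof -
  have "x * y = (\<Sum>i<1::nat. x * y)"
    by simp
  then show ?thesis
    unfolding set_mult_def mem_Collect_eq using assms
    by (intro exI[of _ "1::nat"] exI[of _ "\<lambda>_. x"] exI[of _ "\<lambda>_. y"]) simp
qed

lemma set_mult_add:
  assumes "p \<in> X \<bullet> Y" "q \<in> X \<bullet> Y"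
  shows "p + q \<in> X \<bullet> Y"
proof -
  obtain m :: nat and x y where p: "p = (\<Sum>i<m. x i * y i)" "\<forall>i<m. x i \<in> X \<and> y i \<in> Y"
    using assms(1) unfolding set_mult_def by blast
  obtain n :: nat and x' y' where q: "q = (\<Sum>i<n. x' i * y' i)" "\<forall>i<n. x' i \<in> X \<and> y' i \<in> Y"
    using assms(2) unfolding set_mult_def by blast
  \<comment> \<open>The two lists of summands are concatenated: index \<open>m + k\<close> of the
    joint list is index \<open>k\<close> of the second.\<close>
  define s where "s i = (if i < m then x i else x' (i - m))" for i
  define t where "t i = (if i < m then y i else y' (i - m))" for i
  have "(\<Sum>i<m + k. s i * t i) = p + (\<Sum>i<k. x' i * y' i)" for k
    by (induction k) (simp_all add: p(1) s_def t_def add.assoc)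
  then have "p + q = (\<Sum>i<m + n. s i * t i)"
    by (simp add: q(1))
  moreover have "\<forall>i<m + n. s i \<in> X \<and> t i \<in> Y"
    using p(2) q(2) by (auto simp: s_def t_def)
  ultimately show ?thesis
    unfolding set_mult_def by blast
qed

text \<open>The empty sum gives 0, concatenation gives addition, and a minus sign is absorbed by the
  left factors. Hence it is the left set that has to be a subgroup.\<close>

lemma additive_subgroup_set_mult:
  assumes "additive_subgroup X"
  shows "additive_subgroup (X \<bullet> Y)"
  unfolding additive_subgroup_def
proof (intro conjI ballI)
  show "0 \<in> X \<bullet> Y"
    unfolding set_mult_def mem_Collect_eq by (intro exI[of _ "0::nat"]) simp
next
  fix p assume "p \<in> X \<bullet> Y"
  then obtain m :: nat and x y where p: "p = (\<Sum>i<m. x i * y i)" "\<forall>i<m. x i \<in> X \<and> y i \<in> Y"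
    unfolding set_mult_def by blast
  have "- p = (\<Sum>i<m. - x i * y i)"
    by (simp add: p(1) nonassoc_minus_mult_left sum_negf)
  moreover have "\<forall>i<m. - x i \<in> X \<and> y i \<in> Y"
    using p(2) assms unfolding additive_subgroup_def by blast
  ultimately show "- p \<in> X \<bullet> Y"
    unfolding set_mult_def mem_Collect_eq
    by (intro exI[of _ m] exI[of _ "\<lambda>i. - x i"] exI[of _ y]) simp
qed (rule set_mult_add)

section \<open>Sums of families of subgroups, and directness\<close>

lemma sum_of_subgroupsI:
  "finite F \<Longrightarrow> F \<subseteq> J \<Longrightarrow> (\<And>g. g \<in> F \<Longrightarrow> x g \<in> A g) \<Longrightarrow> (\<Sum>g\<in>F. x g) \<in> sum_of_subgroups J A"
  unfolding sum_of_subgroups_def by blast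

lemma sum_of_subgroupsE:
  assumes "p \<in> sum_of_subgroups J A"
  obtains F x where "finite F" "F \<subseteq> J" "\<And>g. g \<in> F \<Longrightarrow> x g \<in> A g" "p = (\<Sum>g\<in>F. x g)"
  using assms unfolding sum_of_subgroups_def by blast

lemma component_subset_sum_of_subgroups: "g \<in> J \<Longrightarrow> A g \<subseteq> sum_of_subgroups J A"
proof
  fix a assume "g \<in> J" "a \<in> A g"
  then show "a \<in> sum_of_subgroups J A"
    using sum_of_subgroupsI[of "{g}" J "\<lambda>_. a" A] by simp
qed

lemma additive_subgroup_sum_of_subgroups:
  assumes sub: "\<And>g. g \<in> J \<Longrightarrow> additive_subgroup (A g)"
  shows "additive_subgroup (sum_of_subgroups J A)"
  unfolding additive_subgroup_def
proof (intro conjI ballI)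
  show "0 \<in> sum_of_subgroups J A"
    using sum_of_subgroupsI[of "{}" J] by simp
next
  fix p q assume p: "p \<in> sum_of_subgroups J A" and q: "q \<in> sum_of_subgroups J A"
  obtain F x where F: "finite F" "F \<subseteq> J" "\<And>g. g \<in> F \<Longrightarrow> x g \<in> A g" "p = (\<Sum>g\<in>F. x g)"
    using p by (rule sum_of_subgroupsE) blast
  obtain F' x' where F': "finite F'" "F' \<subseteq> J" "\<And>g. g \<in> F' \<Longrightarrow> x' g \<in> A g" "q = (\<Sum>g\<in>F'. x' g)"
    using q by (rule sum_of_subgroupsE) blast
  \<comment> \<open>Both families are extended by 0 to the common index set
    \<open>F \<union> F'\<close>; the padding stays inside the components because they contain
    0.\<close>
  define y where "y g = (if g \<in> F then x g else 0) + (if g \<in> F' then x' g else 0)" for g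
  have "p + q = (\<Sum>g\<in>F \<union> F'. y g)"
    unfolding y_def sum.distrib F(4) F'(4)
    using F(1) F'(1) by (simp add: sum.If_cases Int_absorb1)
  moreover have "y g \<in> A g" if "g \<in> F \<union> F'" for g
  proof -
    have "additive_subgroup (A g)"
      using sub that F(2) F'(2) by blast
    then show ?thesis
      using F(3) F'(3) unfolding y_def additive_subgroup_def by simp
  qed
  ultimately show "p + q \<in> sum_of_subgroups J A"
    using F(1,2) F'(1,2) by (auto intro!: sum_of_subgroupsI)
next
  fix p assume "p \<in> sum_of_subgroups J A"
  then obtain F x where F: "finite F" "F \<subseteq> J" "\<And>g. g \<in> F \<Longrightarrow> x g \<in> A g" "p = (\<Sum>g\<in>F. x g)"
    by (rule sum_of_subgroupsE) blast
  have "- x g \<in> A g" if "g \<in> F" for g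
    using sub F(2,3) that unfolding additive_subgroup_def by blast
  then have "(\<Sum>g\<in>F. - x g) \<in> sum_of_subgroups J A"
    using F(1,2) by (intro sum_of_subgroupsI)
  then show "- p \<in> sum_of_subgroups J A"
    by (simp add: F(4) sum_negf)
qed

text \<open>By distributivity a product of two sums is a sum of products of homogeneous elements, so
  containment in a subgroup may be tested on pairs of components.\<close>

lemma sum_of_subgroups_mult_subset:
  assumes H: "additive_subgroup H"
    and prod: "\<And>g h. g \<in> J \<Longrightarrow> h \<in> K \<Longrightarrow> A g \<bullet> B h \<subseteq> H"
    and x: "x \<in> sum_of_subgroups J A" and y: "y \<in> sum_of_subgroups K B"
  shows "x * y \<in> H"
proof -
  obtain F a where F: "F \<subseteq> J" "\<And>g. g \<in> F \<Longrightarrow> a g \<in> A g" "x = (\<Sum>g\<in>F. a g)"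
    using x by (rule sum_of_subgroupsE) blast
  obtain F' b where F': "F' \<subseteq> K" "\<And>h. h \<in> F' \<Longrightarrow> b h \<in> B h" "y = (\<Sum>h\<in>F'. b h)"
    using y by (rule sum_of_subgroupsE) blast
  have "x * y = (\<Sum>g\<in>F. \<Sum>h\<in>F'. a g * b h)"
    \<comment> \<open>The left factor is expanded first, which puts \<open>g\<close> outside and
      \<open>h\<close> inside in the double sum.\<close>
    unfolding F(3) F'(3) nonassoc_sum_distrib_right unfolding nonassoc_sum_distrib_left ..
  also have "\<dots> \<in> H"
    using F(1,2) F'(1,2) prod mult_in_set_mult
    by (intro additive_subgroup_sum[OF H]) blast
  finally show ?thesis .
qed

lemma direct_sum_disjoint:
  assumes dir: "is_direct_sum S L A" and "J \<subseteq> L" "K \<subseteq> L" "J \<inter> K = {}"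
    and K: "\<And>g. g \<in> K \<Longrightarrow> additive_subgroup (A g)"
    and p: "p \<in> sum_of_subgroups J A" "p \<in> sum_of_subgroups K A"
  shows "p = 0"
proof -
  obtain F x where F: "finite F" "F \<subseteq> J" "\<And>g. g \<in> F \<Longrightarrow> x g \<in> A g" "p = (\<Sum>g\<in>F. x g)"
    using p(1) by (rule sum_of_subgroupsE) blast
  obtain F' y where F': "finite F'" "F' \<subseteq> K" "\<And>g. g \<in> F' \<Longrightarrow> y g \<in> A g" "p = (\<Sum>g\<in>F'. y g)"
    using p(2) by (rule sum_of_subgroupsE) blast
  \<comment> \<open>The two expressions for \<open>p\<close> are glued into one family representing
    \<open>p - p = 0\<close>. Directness then makes every term vanish, in particular each
    \<open>x g\<close>.\<close>
  define z where "z g = (if g \<in> F then x g else - y g)" for g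
  have disj: "F \<inter> F' = {}"
    using F(2) F'(2) assms(4) by blast
  have "(\<Sum>g\<in>F'. z g) = (\<Sum>g\<in>F'. - y g)"
    using disj by (intro sum.cong) (auto simp: z_def)
  then have "(\<Sum>g\<in>F \<union> F'. z g) = p + - p"
    using disj F(1,4) F'(1,4) by (simp add: sum.union_disjoint z_def sum_negf)
  then have "(\<Sum>g\<in>F \<union> F'. z g) = 0"
    by simp
  moreover have "z g \<in> A g" if "g \<in> F \<union> F'" for g
    using that F(3) F'(2,3) K unfolding z_def additive_subgroup_def by auto
  ultimately have z0: "\<forall>g\<in>F \<union> F'. z g = 0"
    using dir[unfolded is_direct_sum_def, THEN conjunct2, THEN spec[of _ "F \<union> F'"], THEN spec[of _ z]]
      F(1,2) F'(1,2) assms(2,3) by blast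
  have "x g = 0" if "g \<in> F" for g
    using z0 that unfolding z_def by force
  then show ?thesis
    by (simp add: F(4))
qed

lemma sum_of_subgroups_split:
  assumes "p \<in> sum_of_subgroups L A"
  obtains q r where "q \<in> sum_of_subgroups J A" "r \<in> sum_of_subgroups (L - J) A" "p = q + r"
proof -
  obtain F x where F: "finite F" "F \<subseteq> L" "\<And>g. g \<in> F \<Longrightarrow> x g \<in> A g" "p = (\<Sum>g\<in>F. x g)"
    using assms by (rule sum_of_subgroupsE) blast
  have "p = (\<Sum>g\<in>F \<inter> J. x g) + (\<Sum>g\<in>F - J. x g)"
    using F(1,4) by (simp add: sum.Int_Diff)
  moreover have "(\<Sum>g\<in>F \<inter> J. x g) \<in> sum_of_subgroups J A"
    "(\<Sum>g\<in>F - J. x g) \<in> sum_of_subgroups (L - J) A"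
    using F by (auto intro!: sum_of_subgroupsI)
  ultimately show ?thesis
    using that by blast
qed

section \<open>Invariant ideals of the object part\<close>

text \<open>These are the two rebracketings used to show that IA is an ideal of A: the first for
  multiplication from the right, the second for multiplication from the left.\<close>

lemma ideal_associativeD:
  assumes "ideal_associative B" "ideal_of I B"
  shows "I \<bullet> UNIV \<bullet> UNIV = I \<bullet> (UNIV \<bullet> UNIV)" "UNIV \<bullet> I \<bullet> UNIV = UNIV \<bullet> (I \<bullet> UNIV)"
proof -
  note assoc = assms(1)[unfolded ideal_associative_def, rule_format, OF assms(2)]
  let ?I = "Factor I" and ?A = "Factor UNIV"
  show "I \<bullet> UNIV \<bullet> UNIV = I \<bullet> (UNIV \<bullet> UNIV)"
    \<comment> \<open>The numerals count the copies of A before and after \<open>I\<close> in the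
      word.\<close>
    using assoc[of "Product (Product ?I ?A) ?A" 0 2 "Product ?I (Product ?A ?A)"]
    by (simp add: numeral_2_eq_2)
  show "UNIV \<bullet> I \<bullet> UNIV = UNIV \<bullet> (I \<bullet> UNIV)"
    using assoc[of "Product (Product ?A ?I) ?A" 1 1 "Product ?A (Product ?I ?A)"]
    by simp
qed

lemma ideal_of_invariant_mult:
  assumes "ideal_associative B" "ideal_of I B" "invariant I"
  shows "ideal_of (I \<bullet> UNIV) UNIV"
  unfolding ideal_of_def
proof (intro conjI ballI)
  note assoc = ideal_associativeD[OF assms(1,2)]
  have right: "I \<bullet> UNIV \<bullet> UNIV \<subseteq> I \<bullet> UNIV"
    unfolding assoc(1) by (rule set_mult_mono) auto
  \<comment> \<open>The chain is A(IA) = (AI)A \<subseteq> (IA)A \<subseteq> IA, where invariance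
    gives the first inclusion and \<open>right\<close> the second.\<close>
  have left: "UNIV \<bullet> (I \<bullet> UNIV) \<subseteq> I \<bullet> UNIV"
    using set_mult_mono[of "UNIV \<bullet> I" "I \<bullet> UNIV" UNIV UNIV] assms(3) right
    unfolding invariant_def assoc(2) by blast
  show "additive_subgroup (I \<bullet> UNIV)"
    using assms(2) unfolding ideal_of_def by (blast intro: additive_subgroup_set_mult)
  fix r x assume "x \<in> I \<bullet> UNIV"
  then show "r * x \<in> I \<bullet> UNIV" "x * r \<in> I \<bullet> UNIV"
    using left right mult_in_set_mult by blast+
qed simp

section \<open>Local units and components of a category-graded ring\<close>

context category_graded_ring
begin

text \<open>The unit is the sum of the identities of those \<open>A e\<close> that occur in
  \<open>x\<close>. It depends on \<open>x\<close>, since \<open>ob\<close> may be infinite and then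
  the identities of all objects cannot be summed.\<close>

lemma object_part_right_unit:
  assumes unital: "locally_unital ob mor d c A" and x: "x \<in> object_part ob A"
  shows "\<exists>u. x * u = x"
proof -
  obtain F a where F: "finite F" "F \<subseteq> ob" "\<And>e. e \<in> F \<Longrightarrow> a e \<in> A e" "x = (\<Sum>e\<in>F. a e)"
    using x unfolding object_part_def by (rule sum_of_subgroupsE) blast
  have "\<forall>e\<in>ob. \<exists>u. identity_of u (A e)"
    using unital unfolding locally_unital_def by blast
  then obtain u where u: "\<And>e. e \<in> ob \<Longrightarrow> identity_of (u e) (A e)"
    by metis
  \<comment> \<open>Distinct objects are never composable, because \<open>d e = e\<close> and
    \<open>c f = f\<close>; so only the diagonal terms of the double sum survive.\<close>
  have "a e * u f = (if e = f then a e else 0)" if "e \<in> F" "f \<in> F" for e f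
  proof (cases "e = f")
    case True
    then show ?thesis
      using that u F(2,3) unfolding identity_of_def by auto
  next
    case False
    have e: "e \<in> ob" and f: "f \<in> ob"
      using that F(2) by auto
    have "A e \<bullet> A f = {0}"
      using e f False ob_subset by (intro mult_not_composable) (auto simp: d_ob c_ob)
    moreover have "a e * u f \<in> A e \<bullet> A f"
      using F(3)[OF that(1)] u[OF f] unfolding identity_of_def by (blast intro: mult_in_set_mult)
    ultimately show ?thesis
      using False by simp
  qed
  then have "(\<Sum>e\<in>F. \<Sum>f\<in>F. a e * u f) = (\<Sum>e\<in>F. \<Sum>f\<in>F. if e = f then a e else 0)"
    by (intro sum.cong refl)
  then have "x * (\<Sum>f\<in>F. u f) = x"
    unfolding F(4) nonassoc_sum_distrib_right unfolding nonassoc_sum_distrib_left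
    using F(1) by simp
  then show ?thesis ..
qed

text \<open>Left multiplication by \<open>A e\<close> keeps degrees: either \<open>e = c g\<close>
  and \<open>comp e g = g\<close>, or the product with \<open>A g\<close> is zero. Thus no term can
  move from a non-object degree into an object degree.\<close>

lemma object_part_mult_complement:
  assumes "x \<in> object_part ob A" "a \<in> sum_of_subgroups (mor - ob) A"
  shows "x * a \<in> sum_of_subgroups (mor - ob) A"
proof -
  have sub: "additive_subgroup (sum_of_subgroups (mor - ob) A)"
    by (intro additive_subgroup_sum_of_subgroups component_subgroup) simp
  have "A e \<bullet> A g \<subseteq> sum_of_subgroups (mor - ob) A" if e: "e \<in> ob" and g: "g \<in> mor - ob" for e g
  proof (cases "e = c g")
    case True
    then have "A e \<bullet> A g \<subseteq> A g"
      using mult_composable[of e g] e g ob_subset comp_id_left[of g] by (auto simp: d_ob)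
    then show ?thesis
      using component_subset_sum_of_subgroups[OF g] by blast
  next
    case False
    then have "A e \<bullet> A g = {0}"
      using e g ob_subset by (intro mult_not_composable) (auto simp: d_ob)
    then show ?thesis
      using sub unfolding additive_subgroup_def by simp
  qed
  then show ?thesis
    using sum_of_subgroups_mult_subset[OF sub] assms unfolding object_part_def by blast
qed

text \<open>Splitting each right factor into its object part and the rest splits \<open>y\<close>
  into a term in \<open>I\<close>, as \<open>I\<close> is an ideal of A_0, and a term in the
  complement. The latter vanishes when \<open>y\<close> lies in A_0.\<close>

lemma ideal_mult_Int_object_part:
  assumes I: "ideal_of I (object_part ob A)"
  shows "I \<bullet> UNIV \<inter> object_part ob A \<subseteq> I"
proof (intro subsetI, elim IntE)
  let ?A0 = "object_part ob A" and ?A' = "sum_of_subgroups (mor - ob) A"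
  have sub0: "additive_subgroup ?A0"
    unfolding object_part_def
    using ob_subset by (intro additive_subgroup_sum_of_subgroups component_subgroup) auto
  have sub': "additive_subgroup ?A'"
    by (intro additive_subgroup_sum_of_subgroups component_subgroup) simp
  fix y assume "y \<in> I \<bullet> UNIV" and y0: "y \<in> ?A0"
  then obtain n :: nat and x a where y: "y = (\<Sum>i<n. x i * a i)" "\<forall>i<n. x i \<in> I"
    unfolding set_mult_def by blast
  \<comment> \<open>The splitting is obtained for every \<open>i\<close>, also beyond
    \<open>n\<close>, so that \<open>q\<close> and \<open>r\<close> can be chosen as total functions
    with no side condition.\<close>
  have "\<exists>q r. q \<in> ?A0 \<and> r \<in> ?A' \<and> a i = q + r" for i
  proof -
    have "a i \<in> sum_of_subgroups mor A"
      using direct_sum unfolding is_direct_sum_def by blast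
    then show ?thesis
      unfolding object_part_def by (rule sum_of_subgroups_split) blast
  qed
  then obtain q r where qr: "\<And>i. q i \<in> ?A0" "\<And>i. r i \<in> ?A'" "\<And>i. a i = q i + r i"
    by metis
  define v where "v = (\<Sum>i<n. x i * q i)"
  define w where "w = (\<Sum>i<n. x i * r i)"
  have yvw: "y = v + w"
    by (simp add: y(1) v_def w_def qr(3) nonassoc_distrib_left sum.distrib)
  have v: "v \<in> I"
    unfolding v_def
    using I y(2) qr(1) unfolding ideal_of_def by (intro additive_subgroup_sum) auto
  have "w \<in> ?A'"
    unfolding w_def using I y(2) qr(2) unfolding ideal_of_def
    by (intro additive_subgroup_sum[OF sub'] object_part_mult_complement) auto
  \<comment> \<open>This difference is \<open>w\<close>, which therefore lies both in A_0 and in the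
    complement.\<close>
  moreover have "y - v \<in> ?A0"
    using sub0 y0 v I unfolding ideal_of_def by (blast intro: additive_subgroup_diff)
  ultimately have "w = 0"
    using direct_sum_disjoint[OF direct_sum, of ob "mor - ob" w] ob_subset component_subgroup
    unfolding yvw object_part_def by auto
  then show "y \<in> I"
    using v yvw by simp
qed

end

theorem proposition3p3:
  fixes ob mor :: "'g set"
    and d c :: "'g \<Rightarrow> 'g"
    and comp :: "'g \<Rightarrow> 'g \<Rightarrow> 'g"
    and A :: "'g \<Rightarrow> 'a::nonassoc_ring set"
  assumes "category_graded_ring ob mor d c comp A"
    and "simple_ring (UNIV :: 'a set)"
    and "ideal_associative (object_part ob A)"
    and "locally_unital ob mor d c A"
  shows "relatively_simple (object_part ob A)"
  unfolding relatively_simple_def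
proof (intro allI impI, elim conjE)
  interpret category_graded_ring ob mor d c comp A
    by (rule assms(1))
  fix I assume I: "ideal_of I (object_part ob A)" and "invariant I"
  then have "ideal_of (I \<bullet> UNIV) UNIV"
    using ideal_of_invariant_mult assms(3) by blast
  then have "I \<bullet> UNIV = {0} \<or> I \<bullet> UNIV = UNIV"
    using assms(2) unfolding simple_ring_def by blast
  then show "I = {0} \<or> I = object_part ob A"
  proof
    \<comment> \<open>Local units enter here: \<open>x = x * u\<close> exhibits \<open>x\<close> as
      a single product in IA, so IA = 0 forces I = 0.\<close>
    have "I \<subseteq> I \<bullet> UNIV"
    proof
      fix x assume x: "x \<in> I"
      then obtain u where "x * u = x"
        using object_part_right_unit[OF assms(4)] I unfolding ideal_of_def by blast
      then show "x \<in> I \<bullet> UNIV"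
        using mult_in_set_mult[OF x UNIV_I, of u] by simp
    qed
    moreover assume "I \<bullet> UNIV = {0}"
    ultimately show ?thesis
      using I unfolding ideal_of_def additive_subgroup_def by blast
  next
    assume "I \<bullet> UNIV = UNIV"
    then show ?thesis
      \<comment> \<open>With IA = A the intersection in this lemma is all of A_0, whence A_0
        \<subseteq> I.\<close>
      using ideal_mult_Int_object_part[OF I] I unfolding ideal_of_def by auto
  qed
qed

end
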